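(* For any positive integer $n$, $$\chi_{3scf}(H_n)=\min\left\{\left\lceil 2\left(1+\log_{2}\frac{n+1}{3}\right)\right\rceil_{e},\ \left\lceil 2\log_{2}(n+1)-1\right\rceil_{o}\right\},$$ where $\lceil x\rceil_{e}$ denotes the smallest even integer that is greater than or equal to $x$, and $\lceil x\rceil_{o}$ denotes the smallest odd integer that is greater than or equal to $x$.
   Context: For a positive integer $n$, let $H_n=(V_n,\mathcal{E}_n)$ be the hypergraph with vertex set $V_n=\{1,2,\dots,n\}$ and hyperedge set $\mathcal{E}_n$ consisting of all non-empty subsets of $V_n$ made of consecutive integers, i.e. all sets $\{i,i+1,\dots,j\}$ with $1\le i\le j\le n$. For a positive integer $k$, a coloring $\phi:V\to\{1,\ldots,m\}$ of a hypergraph $H=(V,\mathcal{E})$ is called a $k$-SCF-coloring ($k$-strong-conflict-free coloring) if for every $e\in\mathcal{E}$ with $|e|\geq k$ there are at least $k$ colors which appear exactly once in $e$ (i.e. are the color of exactly one vertex of $e$), and for every $e\in\mathcal{E}$ with $|e|<k$ all vertices of $e$ have different colors. The chromatic number $\chi_{kscf}(H)$ is the smallest number of colors in any $k$-SCF-coloring of $H$; $\chi_{3scf}$ is the case $k=3$. *)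

theory Defs
  imports Complex_Main
begin

text \<open>A hypergraph is a pair of a vertex set and a set of hyperedges. Vertex sets are meant to be
  finite; \<^const>\<open>card\<close> is only meaningful on hyperedges in that case.\<close>

type_synonym 'a hypergraph = "'a set \<times> 'a set set"

definition interval_hypergraph :: "nat \<Rightarrow> nat hypergraph" where
  "interval_hypergraph n = ({1..n}, {{i..j} | i j. 1 \<le> i \<and> i \<le> j \<and> j \<le> n})"

text \<open>Colors are \<open>{1..m}\<close>; values of \<open>\<phi>\<close> outside the vertex set are irrelevant.\<close>

definition kscf_coloring :: "nat \<Rightarrow> 'a hypergraph \<Rightarrow> nat \<Rightarrow> ('a \<Rightarrow> nat) \<Rightarrow> bool" where
  "kscf_coloring k H m \<phi> \<longleftrightarrow>
     \<phi> ` fst H \<subseteq> {1..m} \<and>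
     (\<forall>e\<in>snd H. card e \<ge> k \<longrightarrow> card {c \<in> {1..m}. \<exists>!v. v \<in> e \<and> \<phi> v = c} \<ge> k) \<and>
     (\<forall>e\<in>snd H. card e < k \<longrightarrow> inj_on \<phi> e)"

text \<open>On a finite hypergraph an injective coloring is always a \<open>k\<close>-SCF-coloring, so the minimum
  exists.\<close>

definition chi_kscf :: "nat \<Rightarrow> 'a hypergraph \<Rightarrow> nat" where
  "chi_kscf k H = (LEAST m. \<exists>\<phi>. kscf_coloring k H m \<phi>)"

definition ceil_even :: "real \<Rightarrow> int" where
  "ceil_even x = (LEAST z. even z \<and> x \<le> of_int z)"

definition ceil_odd :: "real \<Rightarrow> int" where
  "ceil_odd x = (LEAST z. odd z \<and> x \<le> of_int z)"

end

theory Submission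
  imports Defs
begin

text \<open>
  Write \<open>n\<close> for the number of vertices and \<open>m\<close> for the number of colors. The theorem follows from the
  exact condition for \<open>m\<close> colors to suffice, which is that \<open>n + 1\<close> is at most \<open>2, 3, 4, 6, 8, 12, 16, \<dots>\<close>
  for \<open>m = 1, 2, 3, \<dots>\<close>: from the first two values on, two further colors double the bound.
  The bound is \<open>2 ^ (t + 1)\<close> for \<open>m = 2 * t + 1\<close> and \<open>3 * 2 ^ t\<close> for \<open>m = 2 * t + 2\<close>; solving for the
  least odd and the least even \<open>m\<close> gives the two terms of the minimum.

  Two colors cannot do more than double (\<open>card_interval_less_vertex_bound\<close>). Of \<open>n \<ge> 3\<close> vertices,
  at least three have a color of their own; let \<open>u < v < w\<close> be such vertices. To the left of \<open>v\<close>
  the colors of \<open>v\<close> and \<open>w\<close> are missing, to the right of \<open>v\<close> those of \<open>u\<close> and \<open>v\<close>. Either side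
  therefore has two colors fewer, and \<open>n + 1\<close> is the sum of the two sides, each increased by one.

  Two colors do double (\<open>strong_conflict_free_double\<close>). Spread a good coloring of \<open>{1..n}\<close> over the
  even numbers in \<open>{1..2 * n + 1}\<close> and give the odd numbers two new colors alternately. An interval
  with at least three even members inherits three uniquely colored vertices. With two even members,
  both of these are uniquely colored, and so is the odd number between them, since at most one odd
  number follows on each side and these have the other new color. With at most one even member,
  all colors are different.
\<close>

section \<open>Uniquely colored vertices\<close>

definition uniquely_colored :: "('a \<Rightarrow> 'b) \<Rightarrow> 'a set \<Rightarrow> 'a set" where
  "uniquely_colored \<phi> e = {v \<in> e. \<forall>w\<in>e. \<phi> w = \<phi> v \<longrightarrow> w = v}"

lemma uniquely_colored_subset: "uniquely_colored \<phi> e \<subseteq> e"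
  by (auto simp: uniquely_colored_def)

lemma finite_uniquely_colored: "finite e \<Longrightarrow> finite (uniquely_colored \<phi> e)"
  using uniquely_colored_subset finite_subset by metis

lemma inj_on_uniquely_colored: "inj_on \<phi> (uniquely_colored \<phi> e)"
  by (auto simp: uniquely_colored_def inj_on_def)

lemma uniquely_colored_eq_iff: "uniquely_colored \<phi> e = e \<longleftrightarrow> inj_on \<phi> e"
  by (auto simp: uniquely_colored_def inj_on_def)

lemma card_uniquely_colored_le_card_image:
  assumes "finite e"
  shows "card (uniquely_colored \<phi> e) \<le> card (\<phi> ` e)"
proof -
  have "card (uniquely_colored \<phi> e) = card (\<phi> ` uniquely_colored \<phi> e)"
    by (simp add: card_image inj_on_uniquely_colored)
  also have "\<dots> \<le> card (\<phi> ` e)"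
    using assms by (intro card_mono image_mono uniquely_colored_subset) simp
  finally show ?thesis .
qed

text \<open>Counting vertices instead of colors merges the two clauses of a \<open>k\<close>-SCF-coloring into one: a
  hyperedge \<open>e\<close> with fewer than \<open>k\<close> vertices is colored injectively iff all its \<open>card e\<close> vertices
  are uniquely colored.\<close>

lemma kscf_coloring_iff:
  assumes H: "\<And>e. e \<in> snd H \<Longrightarrow> finite e \<and> e \<subseteq> fst H"
  shows "kscf_coloring k H m \<phi> \<longleftrightarrow> \<phi> ` fst H \<subseteq> {1..m} \<and>
    (\<forall>e\<in>snd H. min k (card e) \<le> card (uniquely_colored \<phi> e))"
proof (cases "\<phi> ` fst H \<subseteq> {1..m}")
  case True
  have "(k \<le> card e \<longrightarrow> k \<le> card {c \<in> {1..m}. \<exists>!v. v \<in> e \<and> \<phi> v = c}) \<and>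
        (card e < k \<longrightarrow> inj_on \<phi> e) \<longleftrightarrow> min k (card e) \<le> card (uniquely_colored \<phi> e)"
    if e: "e \<in> snd H" for e
  proof -
    have "{c \<in> {1..m}. \<exists>!v. v \<in> e \<and> \<phi> v = c} = \<phi> ` uniquely_colored \<phi> e"
      using H[OF e] True by (auto simp: uniquely_colored_def image_subset_iff) blast+
    then have colors: "card {c \<in> {1..m}. \<exists>!v. v \<in> e \<and> \<phi> v = c} = card (uniquely_colored \<phi> e)"
      by (simp add: card_image inj_on_uniquely_colored)
    have "inj_on \<phi> e \<longleftrightarrow> card e \<le> card (uniquely_colored \<phi> e)"
      unfolding uniquely_colored_eq_iff[symmetric]
      using H[OF e] uniquely_colored_subset[of \<phi> e] card_seteq by auto
    then show ?thesis
      unfolding colors by auto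
  qed
  then show ?thesis
    using True unfolding kscf_coloring_def by blast
next
  case False
  then show ?thesis
    by (simp add: kscf_coloring_def)
qed

text \<open>The condition for the hypergraph of all intervals inside \<open>{a..b}\<close>. Both ends are parameters
  because the lower bound passes to intervals that do not start at 1.\<close>

definition strong_conflict_free :: "nat \<Rightarrow> (nat \<Rightarrow> 'b) \<Rightarrow> nat \<Rightarrow> nat \<Rightarrow> bool" where
  "strong_conflict_free k \<phi> a b \<longleftrightarrow>
     (\<forall>i j. a \<le> i \<longrightarrow> i \<le> j \<longrightarrow> j \<le> b \<longrightarrow> min k (card {i..j}) \<le> card (uniquely_colored \<phi> {i..j}))"

lemma strong_conflict_free_mono:
  "strong_conflict_free k \<phi> a b \<Longrightarrow> a \<le> a' \<Longrightarrow> b' \<le> b \<Longrightarrow> strong_conflict_free k \<phi> a' b'"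
  unfolding strong_conflict_free_def by (meson le_trans)

lemma strong_conflict_freeD:
  assumes "strong_conflict_free k \<phi> a b" "a \<le> i" "j \<le> b"
  shows "min k (card {i..j}) \<le> card (uniquely_colored \<phi> {i..j})"
  using assms by (cases "i \<le> j") (auto simp: strong_conflict_free_def)

lemma kscf_coloring_interval_hypergraph_iff:
  "kscf_coloring k (interval_hypergraph n) m \<phi> \<longleftrightarrow>
     \<phi> ` {1..n} \<subseteq> {1..m} \<and> strong_conflict_free k \<phi> 1 n"
proof -
  have "kscf_coloring k (interval_hypergraph n) m \<phi> \<longleftrightarrow> \<phi> ` fst (interval_hypergraph n) \<subseteq> {1..m} \<and>
    (\<forall>e\<in>snd (interval_hypergraph n). min k (card e) \<le> card (uniquely_colored \<phi> e))"
    by (rule kscf_coloring_iff) (auto simp: interval_hypergraph_def)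
  also have "\<dots> \<longleftrightarrow> \<phi> ` {1..n} \<subseteq> {1..m} \<and> strong_conflict_free k \<phi> 1 n"
    by (simp only: interval_hypergraph_def strong_conflict_free_def fst_conv snd_conv) blast
  finally show ?thesis .
qed


section \<open>The number of vertices that given colors can serve\<close>

text \<open>One more than the largest number of vertices that \<open>m\<close> colors can serve; with this shift, adding
  two colors doubles the value. The doubling starts only at \<open>m = 1\<close>: three colors
  are needed before an interval has a middle one of three uniquely colored vertices.\<close>

fun vertex_bound :: "nat \<Rightarrow> nat" where
  "vertex_bound 0 = 1"
| "vertex_bound (Suc 0) = 2"
| "vertex_bound (Suc (Suc 0)) = 3"
| "vertex_bound (Suc (Suc (Suc m))) = 2 * vertex_bound (Suc m)"

lemma less_vertex_bound: "m < vertex_bound m"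
  by (induction m rule: vertex_bound.induct) auto

lemma vertex_bound_odd: "vertex_bound (2 * t + 1) = 2 ^ (t + 1)"
  by (induction t) (simp_all add: numeral_2_eq_2)

lemma vertex_bound_even: "vertex_bound (2 * t + 2) = 3 * 2 ^ t"
  by (induction t) (simp_all add: numeral_2_eq_2 numeral_3_eq_3)


section \<open>The lower bound on the number of colors\<close>

lemma three_increasing_elements:
  fixes S :: "'a::linorder set"
  assumes "3 \<le> card S"
  obtains u v w where "u \<in> S" "v \<in> S" "w \<in> S" "u < v" "v < w"
proof -
  obtain T where "T \<subseteq> S" "card T = 3"
    using assms by (meson obtain_subset_with_card_n)
  then obtain x y z where "{x, y, z} \<subseteq> S" "x \<noteq> y" "y \<noteq> z" "x \<noteq> z"
    by (auto simp: card_3_iff)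
  then show ?thesis
    using that by (metis insert_subset linorder_neqE)
qed

text \<open>The induction runs over pieces of an interval together with the restricted coloring, so \<open>m\<close> has
  to bound the number of colors that occur, whichever these are.\<close>

lemma card_interval_less_vertex_bound:
  assumes "strong_conflict_free 3 \<phi> a b" and "card (\<phi> ` {a..b}) \<le> m"
  shows "card {a..b} < vertex_bound m"
proof -
  \<comment> \<open>This covers the cases \<open>m \<le> 2\<close>: without three colors there are at most two vertices, and these
    have different colors.\<close>
  have few: "card {a..b} \<le> m" if "strong_conflict_free 3 \<phi> a b" "card (\<phi> ` {a..b}) \<le> m" "m \<le> 2"
    for a b m
  proof -
    have "min 3 (card {a..b}) \<le> card (uniquely_colored \<phi> {a..b})"
      by (rule strong_conflict_freeD[OF that(1)]) simp_all
    also have "\<dots> \<le> card (\<phi> ` {a..b})"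
      by (rule card_uniquely_colored_le_card_image) simp
    finally show ?thesis using that by linarith
  qed
  show ?thesis
    using assms
  proof (induction m arbitrary: a b rule: vertex_bound.induct)
    case (4 m)
    have many: "min 3 (card {a..b}) \<le> card (uniquely_colored \<phi> {a..b})"
      using strong_conflict_freeD[OF "4.prems"(1)] by simp
    show ?case
    proof (cases "3 \<le> card {a..b}")
      case True
      then have "3 \<le> card (uniquely_colored \<phi> {a..b})"
        using many by simp
      then obtain u v w where uvw: "u \<in> uniquely_colored \<phi> {a..b}" "v \<in> uniquely_colored \<phi> {a..b}"
          "w \<in> uniquely_colored \<phi> {a..b}" "u < v" "v < w"
        by (rule three_increasing_elements)
      then have ab: "a \<le> u" "w \<le> b"
        by (auto simp: uniquely_colored_def)
      have two_fewer: "card (\<phi> ` {c..d}) \<le> Suc m"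
        if cd: "{c..d} \<subseteq> {a..b} - {x, y}" and xy: "x \<noteq> y"
          "x \<in> uniquely_colored \<phi> {a..b}" "y \<in> uniquely_colored \<phi> {a..b}" for c d x y
      proof -
        have "\<phi> ` {c..d} \<subseteq> \<phi> ` {a..b} - {\<phi> x, \<phi> y}"
        proof (rule image_subsetI)
        fix z assume "z \<in> {c..d}"
        then have "z \<in> {a..b}" "z \<noteq> x" "z \<noteq> y" using cd by auto
        then show "\<phi> z \<in> \<phi> ` {a..b} - {\<phi> x, \<phi> y}"
          using xy(2,3) by (auto simp: uniquely_colored_def)
      qed
        then have "card (\<phi> ` {c..d}) \<le> card (\<phi> ` {a..b} - {\<phi> x, \<phi> y})"
          by (intro card_mono) auto
        also have "\<dots> = card (\<phi> ` {a..b}) - card {\<phi> x, \<phi> y}"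
          using xy by (intro card_Diff_subset) (auto simp: uniquely_colored_def)
        also have "card {\<phi> x, \<phi> y} = 2"
          using xy by (auto simp: card_2_iff' uniquely_colored_def)
        finally show ?thesis
          using "4.prems"(2) by linarith
      qed
      have "card (\<phi> ` {a..v - 1}) \<le> Suc m"
        using uvw ab by (intro two_fewer[of _ _ v w]) auto
      then have left: "card {a..v - 1} < vertex_bound (Suc m)"
        using "4.prems"(1) uvw ab by (intro "4.IH") (auto elim: strong_conflict_free_mono)
      have "card (\<phi> ` {v + 1..b}) \<le> Suc m"
        using uvw ab by (intro two_fewer[of _ _ u v]) auto
      then have right: "card {v + 1..b} < vertex_bound (Suc m)"
        using "4.prems"(1) uvw ab by (intro "4.IH") (auto elim: strong_conflict_free_mono)
      have "card {a..b} = card {a..v - 1} + 1 + card {v + 1..b}"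
        using uvw ab by simp
      then show ?thesis
        using left right by simp
    next
      case False
      then show ?thesis
        using less_vertex_bound[of "Suc (Suc (Suc m))"] by linarith
    qed
  next
    case 1
    then show ?case using few[of a b 0] by simp
  next
    case 2
    then show ?case using few[of a b 1] by simp
  next
    case 3
    then show ?case using few[of a b 2] by simp
  qed
qed


section \<open>A coloring with few colors\<close>

definition double :: "(nat \<Rightarrow> nat) \<Rightarrow> nat \<Rightarrow> nat" where
  "double \<phi> p = (if even p then \<phi> (p div 2) + 2 else (p div 2) mod 2 + 1)"

lemma double_even [simp]: "double \<phi> (2 * p) = \<phi> p + 2"
  by (simp add: double_def)

lemma double_odd [simp]: "double \<phi> (Suc (2 * p)) = p mod 2 + 1"
  by (simp add: double_def)

lemma image_double:
  assumes "\<phi> ` {1..n} \<subseteq> {1..m}"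
  shows "double \<phi> ` {1..2 * n + 1} \<subseteq> {1..m + 2}"
proof (rule image_subsetI)
  fix p assume p: "p \<in> {1..2 * n + 1}"
  show "double \<phi> p \<in> {1..m + 2}"
  proof (cases "even p")
    case True
    then obtain q where "p = 2 * q" ..
    then have "q \<in> {1..n}" "p = 2 * q" using p by auto
    then show ?thesis using assms by (auto simp: image_subset_iff)
  next
    case False
    then show ?thesis by (auto simp: double_def)
  qed
qed

text \<open>The odd numbers get the colors 1 and 2. Positivity of \<open>\<phi>\<close> keeps these apart from the shifted
  colors of \<open>\<phi>\<close>.\<close>

lemma strong_conflict_free_double:
  assumes pos: "\<And>p. p \<in> {1..n} \<Longrightarrow> 1 \<le> \<phi> p"
    and free: "strong_conflict_free 3 \<phi> 1 n"
  shows "strong_conflict_free 3 (double \<phi>) 1 (2 * n + 1)"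
  unfolding strong_conflict_free_def
proof (intro allI impI)
  fix i j :: nat
  assume ij: "1 \<le> i" "i \<le> j" "j \<le> 2 * n + 1"
  let ?U = "uniquely_colored (double \<phi>) {i..j}"
  \<comment> \<open>The halves of the even members of the interval.\<close>
  define E where "E = {(i + 1) div 2..j div 2}"
  have E_iff: "q \<in> E \<longleftrightarrow> 2 * q \<in> {i..j}" for q
    by (auto simp: E_def)
  have E_n: "q \<in> {1..n}" if "q \<in> E" for q
    using that ij by (auto simp: E_def)
  have pos': "1 \<le> \<phi> q" if "2 * q \<in> {i..j}" for q
    using that E_iff E_n pos by blast
  have E_many: "min 3 (card E) \<le> card (uniquely_colored \<phi> E)"
    unfolding E_def using ij by (intro strong_conflict_freeD[OF free]) auto
  have evens: "(\<lambda>q. 2 * q) ` uniquely_colored \<phi> E \<subseteq> ?U"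
  proof (rule image_subsetI)
    fix q assume q: "q \<in> uniquely_colored \<phi> E"
    have "p = 2 * q" if p: "p \<in> {i..j}" "double \<phi> p = double \<phi> (2 * q)" for p
    proof (cases "even p")
      case True
      then show ?thesis using p q E_iff by (auto simp: uniquely_colored_def elim!: evenE)
    next
      case False
      \<comment> \<open>Odd numbers have colors at most 2.\<close>
      then have "double \<phi> p \<le> 2" by (auto simp: double_def)
      moreover have "2 * q \<in> {i..j}" using q E_iff by (auto simp: uniquely_colored_def)
      ultimately show ?thesis using p pos'[of q] by simp
    qed
    then show "2 * q \<in> ?U"
      using q E_iff by (auto simp: uniquely_colored_def)
  qed
  have card_evens: "card ((\<lambda>q. 2 * q) ` uniquely_colored \<phi> E) = card (uniquely_colored \<phi> E)"
    by (intro card_image) (auto simp: inj_on_def)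
  have fin: "finite ?U" by (simp add: finite_uniquely_colored)
  consider "3 \<le> card E" | "card E = 2" | "card E \<le> 1" by linarith
  then show "min 3 (card {i..j}) \<le> card ?U"
  proof cases
    case 1
    then show ?thesis
      using E_many card_mono[OF fin evens] card_evens by linarith
  next
    case 2
    define q where "q = (i + 1) div 2"
    have q: "2 * q \<le> i + 1" "i \<le> 2 * q" "2 * q + 2 \<le> j" "j \<le> 2 * q + 3"
      using 2 by (auto simp: E_def q_def)
    have "p = Suc (2 * q)" if p: "p \<in> {i..j}" "double \<phi> p = double \<phi> (Suc (2 * q))" for p
    proof (cases "even p")
      case True
      then show ?thesis using p pos' by (fastforce elim!: evenE)
    next
      case False
      then obtain r where r: "p = Suc (2 * r)" by (auto elim!: oddE)
      then have "r \<le> q + 1" "q \<le> r + 1" using p q by auto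
      moreover have "r mod 2 = q mod 2" using p r by simp
      ultimately have "r = q" by presburger
      then show ?thesis using r by simp
    qed
    then have "Suc (2 * q) \<in> ?U"
      using q by (auto simp: uniquely_colored_def)
    then have "insert (Suc (2 * q)) ((\<lambda>q. 2 * q) ` uniquely_colored \<phi> E) \<subseteq> ?U"
      using evens by blast
    then have "card (insert (Suc (2 * q)) ((\<lambda>q. 2 * q) ` uniquely_colored \<phi> E)) \<le> card ?U"
      by (rule card_mono[OF fin])
    moreover have "Suc (2 * q) \<notin> (\<lambda>q. 2 * q) ` uniquely_colored \<phi> E"
      by (auto dest: arg_cong[where f = even])
    ultimately have "Suc (card (uniquely_colored \<phi> E)) \<le> card ?U"
      using card_evens by (simp add: E_def finite_uniquely_colored)
    then show ?thesis using 2 E_many by linarith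
  next
    case 3
    have "inj_on (double \<phi>) {i..j}"
    proof (rule inj_onI)
      fix v w assume vw: "v \<in> {i..j}" "w \<in> {i..j}" "double \<phi> v = double \<phi> w"
      have "j div 2 \<le> (i + 1) div 2"
        using 3 by (simp add: E_def)
      then have near: "j \<le> i + 2"
        by linarith
      have parity: "even v \<longleftrightarrow> even w"
      proof -
        have "double \<phi> p \<le> 2" if "odd p" for p
          using that by (auto simp: double_def)
        moreover have "3 \<le> double \<phi> p" if p: "even p" "p \<in> {i..j}" for p
          using p pos'[of "p div 2"] by (simp add: double_def)
        ultimately show ?thesis using vw
          by (metis not_less_eq_eq numeral_2_eq_2 numeral_3_eq_3)
      qed
      show "v = w"
      proof (cases "even v")
        case True
        then obtain r s where "v = 2 * r" "w = 2 * s"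
          using parity by (auto elim!: evenE)
        moreover from this have "r \<in> E" "s \<in> E" using vw E_iff by auto
        moreover have "finite E" by (simp add: E_def)
        ultimately show ?thesis using 3 by (auto simp: card_le_Suc0_iff_eq)
      next
        case False
        then obtain r s where rs: "v = Suc (2 * r)" "w = Suc (2 * s)"
          using parity by (auto elim!: oddE)
        then have "r \<le> s + 1" "s \<le> r + 1" using vw near by auto
        moreover have "r mod 2 = s mod 2" using vw rs by simp
        ultimately have "r = s" by presburger
        then show ?thesis using rs by simp
      qed
    qed
    then have "?U = {i..j}" by (simp add: uniquely_colored_eq_iff)
    then show ?thesis by simp
  qed
qed

lemma strong_conflict_free_inj_on:
  assumes "inj_on \<phi> {a..b}"
  shows "strong_conflict_free k \<phi> a b"
  unfolding strong_conflict_free_def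
proof (intro allI impI)
  fix i j assume "a \<le> i" "i \<le> j" "j \<le> b"
  then have "inj_on \<phi> {i..j}"
    by (intro inj_on_subset[OF assms]) auto
  then show "min k (card {i..j}) \<le> card (uniquely_colored \<phi> {i..j})"
    by (simp add: uniquely_colored_eq_iff[THEN iffD2])
qed

lemma exists_strong_conflict_free:
  "\<exists>\<phi>. \<phi> ` {1..vertex_bound m - 1} \<subseteq> {1..m} \<and> strong_conflict_free 3 \<phi> 1 (vertex_bound m - 1)"
proof (induction m rule: vertex_bound.induct)
  case (4 m)
  then obtain \<phi> where \<phi>: "\<phi> ` {1..vertex_bound (Suc m) - 1} \<subseteq> {1..Suc m}"
      "strong_conflict_free 3 \<phi> 1 (vertex_bound (Suc m) - 1)"
    by blast
  have "vertex_bound (Suc (Suc (Suc m))) - 1 = 2 * (vertex_bound (Suc m) - 1) + 1"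
    using less_vertex_bound[of "Suc m"] by simp
  moreover have "double \<phi> ` {1..2 * (vertex_bound (Suc m) - 1) + 1} \<subseteq> {1..Suc m + 2}"
    using \<phi>(1) by (rule image_double)
  moreover have "strong_conflict_free 3 (double \<phi>) 1 (2 * (vertex_bound (Suc m) - 1) + 1)"
    using \<phi> by (intro strong_conflict_free_double) (auto simp: image_subset_iff)
  ultimately show ?case by auto
qed (rule exI[of _ id], simp add: strong_conflict_free_inj_on)+


section \<open>The chromatic number\<close>

lemma kscf_colorable_iff_less_vertex_bound:
  "(\<exists>\<phi>. kscf_coloring 3 (interval_hypergraph n) m \<phi>) \<longleftrightarrow> n < vertex_bound m"
proof
  assume "\<exists>\<phi>. kscf_coloring 3 (interval_hypergraph n) m \<phi>"
  then obtain \<phi> where \<phi>: "\<phi> ` {1..n} \<subseteq> {1..m}" "strong_conflict_free 3 \<phi> 1 n"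
    by (auto simp: kscf_coloring_interval_hypergraph_iff)
  then have "card (\<phi> ` {1..n}) \<le> m"
    using card_mono[OF _ \<phi>(1)] by simp
  with \<phi>(2) have "card {1..n} < vertex_bound m"
    by (rule card_interval_less_vertex_bound)
  then show "n < vertex_bound m" by simp
next
  assume n: "n < vertex_bound m"
  obtain \<phi> where \<phi>: "\<phi> ` {1..vertex_bound m - 1} \<subseteq> {1..m}" "strong_conflict_free 3 \<phi> 1 (vertex_bound m - 1)"
    using exists_strong_conflict_free by blast
  have "\<phi> ` {1..n} \<subseteq> {1..m}"
    using n \<phi>(1) by (auto simp: image_subset_iff)
  moreover have "strong_conflict_free 3 \<phi> 1 n"
    using n by (intro strong_conflict_free_mono[OF \<phi>(2)]) auto
  ultimately show "\<exists>\<phi>. kscf_coloring 3 (interval_hypergraph n) m \<phi>"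
    by (auto simp: kscf_coloring_interval_hypergraph_iff)
qed

lemma ceil_even_eq: "ceil_even (2 * x) = 2 * \<lceil>x\<rceil>"
  unfolding ceil_even_def
proof (rule Least_equality)
  show "even (2 * \<lceil>x\<rceil>) \<and> 2 * x \<le> of_int (2 * \<lceil>x\<rceil>)"
    by simp
next
  fix z assume z: "even z \<and> 2 * x \<le> of_int z"
  then obtain y where y: "z = 2 * y" by blast
  then have "\<lceil>x\<rceil> \<le> y" using z by (intro ceiling_le) auto
  then show "2 * \<lceil>x\<rceil> \<le> z" using y by linarith
qed

lemma ceil_odd_eq: "ceil_odd (2 * x - 1) = 2 * \<lceil>x\<rceil> - 1"
  unfolding ceil_odd_def
proof (rule Least_equality)
  show "odd (2 * \<lceil>x\<rceil> - 1) \<and> 2 * x - 1 \<le> of_int (2 * \<lceil>x\<rceil> - 1)"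
    by simp
next
  fix z assume z: "odd z \<and> 2 * x - 1 \<le> of_int z"
  then obtain y where y: "z = 2 * y + 1" by (blast elim: oddE)
  then have "\<lceil>x\<rceil> \<le> y + 1" using z by (intro ceiling_le) auto
  then show "2 * \<lceil>x\<rceil> - 1 \<le> z" using y by linarith
qed

lemma less_vertex_bound_even_iff:
  "n < vertex_bound (2 * t + 2) \<longleftrightarrow> ceil_even (2 * (1 + log 2 ((real n + 1) / 3))) \<le> int (2 * t + 2)"
proof -
  have "ceil_even (2 * (1 + log 2 ((real n + 1) / 3))) \<le> int (2 * t + 2)
      \<longleftrightarrow> \<lceil>1 + log 2 ((real n + 1) / 3)\<rceil> \<le> int (t + 1)"
    unfolding ceil_even_eq by linarith
  also have "\<dots> \<longleftrightarrow> log 2 ((real n + 1) / 3) \<le> real t"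
    unfolding ceiling_le_iff by simp
  also have "\<dots> \<longleftrightarrow> (real n + 1) / 3 \<le> 2 ^ t"
    by (simp add: log_le_iff powr_realpow)
  also have "\<dots> \<longleftrightarrow> real (n + 1) \<le> real (3 * 2 ^ t)"
    by (simp add: divide_le_eq mult.commute add.commute)
  also have "\<dots> \<longleftrightarrow> n < vertex_bound (2 * t + 2)"
    unfolding of_nat_le_iff vertex_bound_even by linarith
  finally show ?thesis ..
qed

lemma less_vertex_bound_odd_iff:
  "n < vertex_bound (2 * t + 1) \<longleftrightarrow> ceil_odd (2 * log 2 (real n + 1) - 1) \<le> int (2 * t + 1)"
proof -
  have "ceil_odd (2 * log 2 (real n + 1) - 1) \<le> int (2 * t + 1)
      \<longleftrightarrow> \<lceil>log 2 (real n + 1)\<rceil> \<le> int (t + 1)"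
    unfolding ceil_odd_eq by linarith
  also have "\<dots> \<longleftrightarrow> log 2 (real n + 1) \<le> real (t + 1)"
    unfolding ceiling_le_iff of_int_of_nat_eq ..
  also have "\<dots> \<longleftrightarrow> real n + 1 \<le> 2 powr real (t + 1)"
    by (rule log_le_iff) simp_all
  also have "\<dots> \<longleftrightarrow> real (n + 1) \<le> real (2 ^ (t + 1))"
    by (simp only: powr_realpow zero_less_numeral) (simp add: add.commute)
  also have "\<dots> \<longleftrightarrow> n < vertex_bound (2 * t + 1)"
    unfolding of_nat_le_iff vertex_bound_odd by linarith
  finally show ?thesis ..
qed

theorem corollary2p6:
  fixes n :: nat
  assumes "n \<ge> 1"
  shows "int (chi_kscf 3 (interval_hypergraph n)) =
    min (ceil_even (2 * (1 + log 2 ((real n + 1) / 3))))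
        (ceil_odd (2 * log 2 (real n + 1) - 1))"
    (is "int ?\<chi> = min ?e ?o")
proof -
  have chi: "?\<chi> = (LEAST m. n < vertex_bound m)"
    by (simp add: chi_kscf_def kscf_colorable_iff_less_vertex_bound)
  have chi_le: "?\<chi> \<le> m" if "n < vertex_bound m" for m
    unfolding chi using that by (rule Least_le)
  have chi_bound: "n < vertex_bound ?\<chi>"
    unfolding chi using less_vertex_bound by (rule LeastI)
  have "0 < log 2 (2 * ((real n + 1) / 3))"
    using assms by simp
  also have "\<dots> = 1 + log 2 ((real n + 1) / 3)"
    by (subst log_mult) auto
  finally have "0 < \<lceil>1 + log 2 ((real n + 1) / 3)\<rceil>"
    unfolding zero_less_ceiling .
  then have "?e = int (2 * nat (\<lceil>1 + log 2 ((real n + 1) / 3)\<rceil> - 1) + 2)"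
    unfolding ceil_even_eq by linarith
  then obtain s where s: "?e = int (2 * s + 2)" by blast
  have "0 < log 2 (real n + 1)"
    using assms by simp
  then have "0 < \<lceil>log 2 (real n + 1)\<rceil>"
    unfolding zero_less_ceiling .
  then have "?o = int (2 * nat (\<lceil>log 2 (real n + 1)\<rceil> - 1) + 1)"
    unfolding ceil_odd_eq by linarith
  then obtain t where t: "?o = int (2 * t + 1)" by blast
  have "int ?\<chi> \<le> ?e"
    using chi_le[of "2 * s + 2"] less_vertex_bound_even_iff[of n s] s by simp
  moreover have "int ?\<chi> \<le> ?o"
    using chi_le[of "2 * t + 1"] less_vertex_bound_odd_iff[of n t] t by simp
  moreover have "?e \<le> int ?\<chi> \<or> ?o \<le> int ?\<chi>"
  proof (cases "even ?\<chi>")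
    case True
    have "?\<chi> \<noteq> 0"
      using chi_bound assms by (metis not_less vertex_bound.simps(1))
    with True have "?\<chi> = 2 * (?\<chi> div 2 - 1) + 2" by presburger
    then obtain r where "?\<chi> = 2 * r + 2" by blast
    then show ?thesis
      using chi_bound less_vertex_bound_even_iff by metis
  next
    case False
    then obtain r where "?\<chi> = 2 * r + 1" by (rule oddE)
    then show ?thesis
      using chi_bound less_vertex_bound_odd_iff by metis
  qed
  ultimately show ?thesis by linarith
qed

end
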